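(* Let $G=(V,E)$ be a finite strongly connected simple digraph with $|V|=n$ and distance matrix $D$, such that both $DK=n\mathbf 1$ and $D^TK=n\mathbf 1$ admit solutions. Suppose that $G$ admits nonnegative in- and out-curvature $\mu^{\mathrm{in}},\mu^{\mathrm{out}}$. Then for any probability measure $\eta:V\to[0,1]$, $$\min_{v\in V}\sum_{w\in V}d(w,v)\eta(w)\ \le\ \frac{n}{\|\mu^{\mathrm{in}}\|_{\ell_1}}\ \le\ \max_{v\in V}\sum_{w\in V}d(v,w)\eta(w).$$
   Context: A digraph is simple if it has no multiple arcs and no loops (opposite arcs may both be present); it is strongly connected if every vertex is reachable from every other by a directed path; $d(v,w)$ is the length of a shortest directed path from $v$ to $w$; $D=(d(v,w))_{v,w\in V}$; $\mathbf 1\in\mathbb R^n$ is the all-ones column vector. A probability measure $\eta:V\to[0,1]$ satisfies $\sum_{w\in V}\eta(w)=1$. Steinerberger curvatures of the digraph: the out-curvature $\mu^{\mathrm{out}}:V\to\mathbb R$ is the solution of $DK=n\mathbf 1$ if it is unique, and if there are several solutions it is the one achieving $\max_K\min_i K_i$ over all solutions $K$; the in-curvature $\mu^{\mathrm{in}}:V\to\mathbb R$ is defined in the same way with $D^TK=n\mathbf 1$ in place of $DK=n\mathbf 1$. Thus $\sum_{w}d(v,w)\mu^{\mathrm{out}}(w)=n$ and $\sum_w d(w,v)\mu^{\mathrm{in}}(w)=n$ for all $v\in V$. Notation: $\|\mu\|_{\ell_1}=\sum_{w\in V}\mu(w)$. *)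

theory Defs
  imports
    Complex_Main
    "HOL-Library.FuncSet"
    "Graph_Theory.Digraph_Component"
    "Graph_Theory.Shortest_Path"
begin

definition digraph_dist :: "('a, 'b) pre_digraph \<Rightarrow> 'a \<Rightarrow> 'a \<Rightarrow> nat" where
  "digraph_dist G v w = (LEAST k. \<exists>p. pre_digraph.apath G v p w \<and> length p = k)"

text \<open>On a strongly connected digraph this is the library's shortest path cost for unit weights.\<close>

lemma (in wf_digraph) digraph_dist_eq_mu:
  assumes "v \<rightarrow>\<^sup>* w"
  shows "ereal (real (digraph_dist G v w)) = \<mu> (\<lambda>_. 1) v w"
proof -
  have cost: "awalk_cost (\<lambda>_. 1) p = real (length p)" for p :: "'b list"
    by (induction p) auto
  have ex: "\<exists>k p. apath v p w \<and> length p = k"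
    using assms by (simp add: reachable_apath)
  obtain p where p: "apath v p w" "length p = digraph_dist G v w"
    using LeastI_ex[OF ex] unfolding digraph_dist_def by blast
  have le: "digraph_dist G v w \<le> length q" if q: "awalk v q w" for q
  proof -
    have "apath v (awalk_to_apath q) w"
      using q by (rule apath_awalk_to_apath)
    then have "digraph_dist G v w \<le> length (awalk_to_apath q)"
      unfolding digraph_dist_def by (blast intro: Least_le)
    also have "\<dots> \<le> length q"
      using q
    proof (induction rule: awalk_to_apath_induct)
      case (path p)
      then show ?case
        by (auto simp: awalk_to_apath.simps)
    next
      case (decomp p q r s)
      have "p = q @ r @ s"
        using decomp by (auto elim: awalk_cyc_decompE)
      then show ?case
        using decomp.IH step_awalk_to_apath[OF decomp.hyps] by simp
    qed
    finally show ?thesis .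
  qed
  show ?thesis
  proof (rule antisym)
    show "ereal (real (digraph_dist G v w)) \<le> \<mu> (\<lambda>_. 1) v w"
      unfolding \<mu>_def using le by (auto intro!: INF_greatest simp: cost)
    show "\<mu> (\<lambda>_. 1) v w \<le> ereal (real (digraph_dist G v w))"
      using min_cost_le_walk_cost[of v p w "\<lambda>_. 1"] p by (simp add: cost apath_def)
  qed
qed

text \<open>Matrices over a vertex set are functions of two vertices, and vectors are functions on
  the vertex set; extensionality makes ``the solution is unique'' mean uniqueness as a function
  on \<open>V\<close>.\<close>

definition dist_matrix :: "('a, 'b) pre_digraph \<Rightarrow> 'a \<Rightarrow> 'a \<Rightarrow> real" where
  "dist_matrix G v w = real (digraph_dist G v w)"

definition curvature_solutions :: "'a set \<Rightarrow> ('a \<Rightarrow> 'a \<Rightarrow> real) \<Rightarrow> ('a \<Rightarrow> real) set" where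
  "curvature_solutions V M =
     {K \<in> V \<rightarrow>\<^sub>E UNIV. \<forall>v\<in>V. (\<Sum>w\<in>V. M v w * K w) = real (card V)}"

text \<open>If there are several solutions, the max-min one need not be unique, so being a curvature
  is a predicate satisfied by each of them.\<close>

definition is_curvature :: "'a set \<Rightarrow> ('a \<Rightarrow> 'a \<Rightarrow> real) \<Rightarrow> ('a \<Rightarrow> real) \<Rightarrow> bool" where
  "is_curvature V M K \<longleftrightarrow>
     (if \<exists>!L. L \<in> curvature_solutions V M then K \<in> curvature_solutions V M
      else is_arg_max (\<lambda>L. MIN v\<in>V. L v) (\<lambda>L. L \<in> curvature_solutions V M) K)"

definition is_out_curvature :: "('a, 'b) pre_digraph \<Rightarrow> ('a \<Rightarrow> real) \<Rightarrow> bool" where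
  "is_out_curvature G K \<longleftrightarrow> is_curvature (verts G) (dist_matrix G) K"

definition is_in_curvature :: "('a, 'b) pre_digraph \<Rightarrow> ('a \<Rightarrow> real) \<Rightarrow> bool" where
  "is_in_curvature G K \<longleftrightarrow> is_curvature (verts G) (\<lambda>v w. dist_matrix G w v) K"

text \<open>The sum is signed, without absolute values; it is the usual norm when \<open>m \<ge> 0\<close>.\<close>

definition l1_norm :: "'a set \<Rightarrow> ('a \<Rightarrow> real) \<Rightarrow> real" where
  "l1_norm V m = (\<Sum>w\<in>V. m w)"

end

theory Submission
  imports Defs
begin

text \<open>
  The theorem is a minimax statement, as in a zero-sum game with payoff matrix \<open>D\<close>. A nonnegative
  solution \<open>\<mu>\<close> of the transposed system, rescaled to total mass one, is a mixed strategy against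
  which every vertex \<open>w\<close> has the same payoff \<open>n / \<parallel>\<mu>\<parallel>\<close>. Hence the \<open>\<mu>\<close>-average of the potential
  \<open>v \<mapsto> \<Sum>\<^sub>w d(v,w) \<eta>(w)\<close> of a probability measure \<open>\<eta>\<close> is \<open>n / \<parallel>\<mu>\<parallel>\<close> whatever \<open>\<eta>\<close> is, and an average
  lies between minimum and maximum (\<open>constant_column_sums_bounds\<close>).

  With the in-curvature and \<open>D\<close> this gives the upper inequality. With the out-curvature and the
  transpose of \<open>D\<close> it gives the lower one, but with the mass of the out-curvature in the
  denominator. The two masses agree: evaluating the bilinear form of \<open>D\<close> at the two curvatures
  row by row or column by column yields \<open>n\<close> times either mass (\<open>solution_masses_eq\<close>).
\<close>

lemma is_curvature_imp_solution:
  assumes "is_curvature V M K"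
  shows "K \<in> curvature_solutions V M"
  using assms unfolding is_curvature_def by (auto simp: is_arg_max_def split: if_splits)

lemma curvature_solutionsD:
  assumes "K \<in> curvature_solutions V M" "v \<in> V"
  shows "(\<Sum>w\<in>V. M v w * K w) = real (card V)"
  using assms unfolding curvature_solutions_def by blast

text \<open>A nonnegative vector with zero sum vanishes, and the zero vector does not satisfy the
  equation at any vertex because its right-hand side is positive.\<close>

lemma solution_mass_pos:
  assumes "finite V" "V \<noteq> {}"
    and K: "K \<in> curvature_solutions V M"
    and nonneg: "\<forall>v\<in>V. 0 \<le> K v"
  shows "0 < l1_norm V K"
proof (rule ccontr)
  assume "\<not> 0 < l1_norm V K"
  moreover have "0 \<le> l1_norm V K"
    using nonneg unfolding l1_norm_def by (simp add: sum_nonneg)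
  ultimately have "\<forall>v\<in>V. K v = 0"
    using assms(1) nonneg sum_nonneg_eq_0_iff[of V K] unfolding l1_norm_def by auto
  moreover obtain v where "v \<in> V" using assms(2) by blast
  ultimately have "real (card V) = 0"
    using curvature_solutionsD[OF K] by fastforce
  then show False using assms(1,2) by simp
qed

text \<open>The bilinear form \<open>\<Sum>\<^sub>v \<Sum>\<^sub>w K v * M v w * L w\<close> equals \<open>card V\<close> times the sum of \<open>K\<close> when the
  inner sum is over \<open>w\<close>, and \<open>card V\<close> times the sum of \<open>L\<close> when it is over \<open>v\<close>.\<close>

lemma solution_masses_eq:
  assumes "finite V" "V \<noteq> {}"
    and L: "L \<in> curvature_solutions V M"
    and K: "K \<in> curvature_solutions V (\<lambda>v w. M w v)"
  shows "l1_norm V K = l1_norm V L"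
proof -
  have "real (card V) * l1_norm V K = (\<Sum>v\<in>V. K v * (\<Sum>w\<in>V. M v w * L w))"
    using curvature_solutionsD[OF L]
    by (simp add: l1_norm_def mult.commute flip: sum_distrib_right)
  also have "\<dots> = (\<Sum>v\<in>V. \<Sum>w\<in>V. L w * (M v w * K v))"
    by (simp add: sum_distrib_left mult_ac)
  also have "\<dots> = (\<Sum>w\<in>V. L w * (\<Sum>v\<in>V. M v w * K v))"
    by (subst sum.swap) (simp add: sum_distrib_left)
  also have "\<dots> = real (card V) * l1_norm V L"
    using curvature_solutionsD[OF K]
    by (simp add: l1_norm_def mult.commute flip: sum_distrib_right)
  finally show ?thesis using assms(1,2) by simp
qed

text \<open>Exchanging the two summations shows that \<open>\<Sum>\<^sub>v K v * (\<Sum>\<^sub>w M v w * \<eta> w)\<close> is \<open>c\<close> times the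
  mass of \<open>\<eta>\<close>, so \<open>c\<close> is a combination of the row potentials with nonnegative weights \<open>K\<close>.\<close>

lemma constant_column_sums_bounds:
  fixes M :: "'a \<Rightarrow> 'a \<Rightarrow> real"
  assumes "finite V"
    and nonneg: "\<forall>v\<in>V. 0 \<le> K v"
    and columns: "\<And>w. w \<in> V \<Longrightarrow> (\<Sum>v\<in>V. M v w * K v) = c"
    and mass: "(\<Sum>w\<in>V. \<eta> w) = 1"
  shows "(MIN v\<in>V. \<Sum>w\<in>V. M v w * \<eta> w) * l1_norm V K \<le> c"
    and "c \<le> (MAX v\<in>V. \<Sum>w\<in>V. M v w * \<eta> w) * l1_norm V K"
proof -
  define P where "P v = (\<Sum>w\<in>V. M v w * \<eta> w)" for v
  have "(\<Sum>v\<in>V. K v * P v) = (\<Sum>v\<in>V. \<Sum>w\<in>V. \<eta> w * (M v w * K v))"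
    by (simp add: P_def sum_distrib_left mult_ac)
  also have "\<dots> = (\<Sum>w\<in>V. \<eta> w * (\<Sum>v\<in>V. M v w * K v))"
    by (subst sum.swap) (simp add: sum_distrib_left)
  also have "\<dots> = c"
    using mass by (simp add: columns flip: sum_distrib_right)
  finally have avg: "(\<Sum>v\<in>V. K v * P v) = c" .
  have "(MIN v\<in>V. P v) * l1_norm V K \<le> (\<Sum>v\<in>V. K v * P v)"
    unfolding l1_norm_def sum_distrib_left
    using assms(1) nonneg
    by (intro sum_mono) (simp add: mult.commute mult_left_mono)
  then show "(MIN v\<in>V. \<Sum>w\<in>V. M v w * \<eta> w) * l1_norm V K \<le> c"
    unfolding avg by (simp only: P_def)
  have "(\<Sum>v\<in>V. K v * P v) \<le> (MAX v\<in>V. P v) * l1_norm V K"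
    unfolding l1_norm_def sum_distrib_left
    using assms(1) nonneg
    by (intro sum_mono) (simp add: mult.commute mult_left_mono)
  then show "c \<le> (MAX v\<in>V. \<Sum>w\<in>V. M v w * \<eta> w) * l1_norm V K"
    unfolding avg by (simp only: P_def)
qed

theorem theorem4p9:
  fixes G :: "('a, 'b) pre_digraph"
    and n :: nat
    and mu_in mu_out eta :: "'a \<Rightarrow> real"
  assumes "digraph G"
    and "strongly_connected G"
    and "card (verts G) = n"
    and "curvature_solutions (verts G) (dist_matrix G) \<noteq> {}"
    and "curvature_solutions (verts G) (\<lambda>v w. dist_matrix G w v) \<noteq> {}"
    and "is_in_curvature G mu_in"
    and "is_out_curvature G mu_out"
    and "\<forall>v\<in>verts G. 0 \<le> mu_in v"
    and "\<forall>v\<in>verts G. 0 \<le> mu_out v"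
    and "eta \<in> verts G \<rightarrow> {0..1}"
    and "(\<Sum>w\<in>verts G. eta w) = 1"
  shows "(MIN v\<in>verts G. \<Sum>w\<in>verts G. dist_matrix G w v * eta w)
           \<le> real n / l1_norm (verts G) mu_in \<and>
         real n / l1_norm (verts G) mu_in
           \<le> (MAX v\<in>verts G. \<Sum>w\<in>verts G. dist_matrix G v w * eta w)"
proof -
  let ?V = "verts G" and ?D = "dist_matrix G"
  interpret digraph G by fact
  have fin: "finite ?V" by simp
  have ne: "?V \<noteq> {}" using assms(11) by force
  have sol_in: "mu_in \<in> curvature_solutions ?V (\<lambda>v w. ?D w v)"
    using assms(6) unfolding is_in_curvature_def by (rule is_curvature_imp_solution)
  have sol_out: "mu_out \<in> curvature_solutions ?V ?D"
    using assms(7) unfolding is_out_curvature_def by (rule is_curvature_imp_solution)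
  have pos: "0 < l1_norm ?V mu_in"
    using fin ne sol_in assms(8) by (rule solution_mass_pos)
  have masses: "l1_norm ?V mu_in = l1_norm ?V mu_out"
    using fin ne sol_out sol_in by (rule solution_masses_eq)
  have "(MIN v\<in>?V. \<Sum>w\<in>?V. ?D w v * eta w) * l1_norm ?V mu_out \<le> real n"
    using constant_column_sums_bounds(1)[of ?V mu_out "\<lambda>v w. ?D w v" "real n" eta]
      fin assms(3,9,11) curvature_solutionsD[OF sol_out] by simp
  moreover have "real n \<le> (MAX v\<in>?V. \<Sum>w\<in>?V. ?D v w * eta w) * l1_norm ?V mu_in"
    using constant_column_sums_bounds(2)[of ?V mu_in ?D "real n" eta]
      fin assms(3,8,11) curvature_solutionsD[OF sol_in] by simp
  ultimately show ?thesis
    using pos masses by (simp add: pos_le_divide_eq pos_divide_le_eq)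
qed

end
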